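(* Let $F \subset \mathbb{R}^2$ be a non-empty set (no measurability or compactness is assumed). Then, for Lebesgue almost all $\theta \in [0,\pi)$, $$\dim_{\mathrm{A}} \pi_\theta F \ \geq \ \min\{\dim_{\mathrm{A}} F,\, 1\}.$$
   Context: For $\theta\in[0,\pi)$, $\pi_\theta$ denotes orthogonal projection of $\mathbb{R}^2$ onto the line through the origin forming angle $\theta$ with the positive $x$-axis (the line may be identified isometrically with $\mathbb{R}$). For a non-empty set $E\subseteq\mathbb{R}^d$ and $r>0$, $N_r(E)$ is the smallest number of open sets of diameter at most $r$ needed to cover $E$. The Assouad dimension of a non-empty set $F\subseteq\mathbb{R}^d$ is $$\dim_{\mathrm{A}}F=\inf\Big\{s\ge 0:\ (\exists C>0)(\forall R>0)(\forall r\in(0,R))(\forall x\in F)\ N_r(B(x,R)\cap F)\le C\Big(\frac{R}{r}\Big)^s\Big\},$$ where $B(x,R)$ is the open Euclidean ball with centre $x$ and radius $R$. *)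

theory Defs
  imports "HOL-Analysis.Analysis"
begin

text \<open>
  \<open>diameter\<close> is real-valued and carries no information on unbounded sets,
  hence the explicit boundedness requirement on the covering sets.  If no finite cover exists,
  the infimum is over the empty set and equals \<open>\<infinity>\<close>.
\<close>

definition covering_number :: "real \<Rightarrow> 'a::metric_space set \<Rightarrow> enat" where
  "covering_number r E =
     Inf {enat (card \<U>) | \<U>. finite \<U> \<and>
            (\<forall>U\<in>\<U>. open U \<and> bounded U \<and> diameter U \<le> r) \<and> E \<subseteq> \<Union>\<U>}"

definition assouad_dim :: "'a::metric_space set \<Rightarrow> ereal" where
  "assouad_dim F =
     Inf {ereal s | s. s \<ge> 0 \<and>
            (\<exists>C>0. \<forall>R>0. \<forall>r\<in>{0<..<R}. \<forall>x\<in>F.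
               ereal_of_enat (covering_number r (ball x R \<inter> F)) \<le> ereal (C * (R / r) powr s))}"

definition direction :: "real \<Rightarrow> real ^ 2" where
  "direction \<theta> = vector [cos \<theta>, sin \<theta>]"

definition proj_line :: "real \<Rightarrow> real ^ 2 \<Rightarrow> real ^ 2" where
  "proj_line \<theta> x = (x \<bullet> direction \<theta>) *\<^sub>R direction \<theta>"

lemma norm_direction: "norm (direction \<theta>) = 1"
  by (simp add: direction_def norm_eq_1 inner_vec_def sum_2 power2_eq_square [symmetric])

text \<open>\<open>proj_line \<theta>\<close> is the orthogonal projection onto the line \<open>span {direction \<theta>}\<close>.\<close>

lemma proj_line_in_span: "proj_line \<theta> x \<in> span {direction \<theta>}"
  by (simp add: proj_line_def span_base span_scale)

lemma proj_line_orthogonal: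
  assumes "y \<in> span {direction \<theta>}"
  shows "orthogonal (x - proj_line \<theta> x) y"
proof -
  from assms obtain k where "y = k *\<^sub>R direction \<theta>"
    by (auto simp: span_singleton)
  moreover have "direction \<theta> \<bullet> direction \<theta> = 1"
    using norm_direction [of \<theta>] by (simp add: norm_eq_1)
  ultimately show ?thesis
    by (simp add: orthogonal_def proj_line_def inner_diff_left)
qed

end

theory Submission
  imports Defs
begin

text \<open>
  This is a discrete form of Kaufman's energy argument for Marstrand's projection theorem, applied
  to finite subsets of \<open>F\<close> at one pair of scales at a time.

  Let \<open>t < s < min (dim F) 1\<close>.  As the defining estimate of the Assouad dimension fails for the
  exponent \<open>s\<close> with every constant, there are finite \<open>\<delta>\<close>-separated subsets of \<open>F\<close> with far more
  than \<open>(R/\<delta>)\<^sup>s\<close> points in a ball of radius \<open>R\<close>.  Such a set may be badly concentrated, so one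
  zooms in on the ball \<open>B(x, 2\<^sup>k\<delta>)\<close> that maximises the number of points divided by \<open>2\<^bsup>ks\<^esup>\<close>.
  Maximality is precisely a Frostman condition for the part \<open>E\<close> of the set in this ball: a ball of
  radius \<open>2\<^sup>j\<delta>\<close> centred in \<open>E\<close> has at most the fraction \<open>2\<^bsup>(j-k)s\<^esup>\<close> of the points of \<open>E\<close>.  The set \<open>E\<close>
  has at least a large multiple of \<open>2\<^bsup>ks\<^esup>\<close> points, but being separated it has \<open>O(2\<^bsup>2k\<^esup>)\<close> points; so
  \<open>k\<close> can be made as large as one likes (\<open>ex_large_frostman_subset\<close>).

  The projections of \<open>y\<close> and \<open>z\<close> are within \<open>\<delta>\<close> of each other only for a set of angles of measure
  \<open>O(\<delta>/dist y z)\<close>.  Since \<open>s < 1\<close>, the Frostman condition bounds the sum of these measures over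
  all pairs by \<open>O(|E|\<^sup>2 2\<^bsup>-ks\<^esup>)\<close>; the dyadic shells around a point form a geometric series
  (\<open>frostman_energy_le\<close>).  On the other hand, if the projection of \<open>E\<close> is covered by
  \<open>N = C 2\<^bsup>kt\<^esup>\<close> sets of diameter \<open>\<delta>\<close>, then by the Cauchy-Schwarz inequality at least \<open>|E|\<^sup>2/N\<close>
  pairs have \<open>\<delta>\<close>-close projections (\<open>card_squared_le_close_pairs\<close>).  By Markov's inequality this
  happens only for a set of angles of measure \<open>O(2\<^bsup>k(t-s)\<^esup>)\<close>, which tends to \<open>0\<close> as \<open>k\<close> grows.
  Hence, for fixed \<open>t\<close> and \<open>C\<close>, the angles for which the projection of \<open>F\<close> satisfies the
  estimate in the definition of the Assouad dimension are contained in sets of arbitrarily small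
  measure (\<open>negligible_exceptional_directions\<close>).  Countably many pairs \<open>(t, C)\<close> suffice.
\<close>

section \<open>Separated sets and covering numbers\<close>

text \<open>
  The balls of radius \<open>\<delta>/2\<close> around the points of a \<open>\<delta>\<close>-separated set are disjoint and lie in a
  ball of radius \<open>\<rho> + \<delta>/2\<close>; compare volumes.
\<close>

lemma card_separated_le:
  fixes E :: "'a::euclidean_space set"
  assumes "finite E" "E \<subseteq> ball c \<rho>" "pairwise (\<lambda>y z. \<delta> \<le> dist y z) E" "\<delta> > 0" "\<rho> > 0"
  shows "real (card E) \<le> (2 * \<rho> / \<delta> + 1) ^ DIM('a)"
proof -
  define V where "V = measure lborel (ball (0::'a) 1)"
  have V: "V > 0"
    unfolding V_def by (rule content_ball_pos) simp
  have vol: "measure lborel (ball y t) = t ^ DIM('a) * V" if "t \<ge> 0" for y :: 'a and t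
    unfolding V_def using that by (rule content_ball_conv_unit_ball)
  have fmeas: "ball y t \<in> fmeasurable lborel" for y :: 'a and t
    by (rule fmeasurableI) (use emeasure_lborel_ball_finite[of y t] in simp_all)
  have disj: "disjoint_family_on (\<lambda>y. ball y (\<delta>/2)) E"
  proof (clarsimp simp: disjoint_family_on_def disjoint_iff)
    fix y z w assume "y \<in> E" "z \<in> E" "y \<noteq> z" "dist y w * 2 < \<delta>" "dist z w * 2 < \<delta>"
    moreover have "dist y z \<le> dist y w + dist z w"
      by (metis dist_commute dist_triangle)
    moreover have "\<delta> \<le> dist y z"
      using assms(3) calculation by (auto simp: pairwise_def)
    ultimately show False by linarith
  qed
  have "real (card E) * ((\<delta>/2) ^ DIM('a) * V) = (\<Sum>y\<in>E. measure lborel (ball y (\<delta>/2)))"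
    using assms(4) by (simp add: vol)
  also have "\<dots> = measure lborel (\<Union>y\<in>E. ball y (\<delta>/2))"
    by (rule measure_finite_Union[symmetric]) (use assms(1) disj fmeasurableD2[OF fmeas] in auto)
  also have "\<dots> \<le> measure lborel (ball c (\<rho> + \<delta>/2))"
  proof (rule measure_mono_fmeasurable)
    show "(\<Union>y\<in>E. ball y (\<delta>/2)) \<subseteq> ball c (\<rho> + \<delta>/2)"
    proof clarsimp
      fix y w assume "y \<in> E" "dist y w * 2 < \<delta>"
      moreover have "dist c y < \<rho>" using \<open>y \<in> E\<close> assms(2) by auto
      moreover have "dist c w \<le> dist c y + dist y w" by (rule dist_triangle)
      ultimately show "dist c w < \<rho> + \<delta>/2" by linarith
    qed
    show "(\<Union>y\<in>E. ball y (\<delta>/2)) \<in> sets lborel"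
      by (simp add: open_UN borel_open)
  qed (rule fmeas)
  also have "\<dots> = (\<rho> + \<delta>/2) ^ DIM('a) * V"
    using assms(4,5) by (simp add: vol)
  finally have "real (card E) * (\<delta>/2) ^ DIM('a) \<le> (\<rho> + \<delta>/2) ^ DIM('a)"
    using V by simp
  then have "real (card E) \<le> (\<rho> + \<delta>/2) ^ DIM('a) / (\<delta>/2) ^ DIM('a)"
    using assms(4) by (simp add: pos_le_divide_eq)
  also have "\<dots> = (2 * \<rho> / \<delta> + 1) ^ DIM('a)"
  proof -
    have "2 * \<rho> / \<delta> + 1 = (\<rho> + \<delta>/2) / (\<delta>/2)"
      using assms(4) by (simp add: field_simps)
    then show ?thesis by (simp only: power_divide)
  qed
  finally show ?thesis .
qed

text \<open>
  A separated subset of greatest cardinality is a net, for a point that it misses could be added to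
  it.  The volume bound makes the greatest cardinality finite.
\<close>

lemma ex_maximal_separated_subset:
  fixes A :: "'a::euclidean_space set"
  assumes "bounded A" "\<delta> > 0"
  obtains E where "finite E" "E \<subseteq> A" "pairwise (\<lambda>y z. \<delta> \<le> dist y z) E"
    "A \<subseteq> (\<Union>y\<in>E. ball y \<delta>)"
proof -
  define P where "P n \<longleftrightarrow> (\<exists>E. finite E \<and> E \<subseteq> A \<and> pairwise (\<lambda>y z. \<delta> \<le> dist y z) E \<and> card E = n)" for n
  obtain \<rho> where \<rho>: "\<rho> > 0" "A \<subseteq> ball 0 \<rho>"
    using assms(1) bounded_subset_ballD by blast
  obtain M where M: "(2 * \<rho> / \<delta> + 1) ^ DIM('a) \<le> real M"
    using real_arch_simple by blast
  have bound: "n \<le> M" if "P n" for n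
  proof -
    obtain E where E: "finite E" "E \<subseteq> A" "pairwise (\<lambda>y z. \<delta> \<le> dist y z) E" "card E = n"
      using \<open>P n\<close> by (auto simp: P_def)
    have "real (card E) \<le> (2 * \<rho> / \<delta> + 1) ^ DIM('a)"
      using E \<rho> assms(2) by (intro card_separated_le[of E 0]) auto
    then show ?thesis using M E(4) by linarith
  qed
  have "P 0"
    by (auto simp: P_def intro!: exI[of _ "{}"])
  then have G: "P (Greatest P)"
    using bound by (rule GreatestI_nat)
  have Gmax: "n \<le> Greatest P" if "P n" for n
    using that bound by (rule Greatest_le_nat)
  from G obtain E where E: "finite E" "E \<subseteq> A" "pairwise (\<lambda>y z. \<delta> \<le> dist y z) E" "card E = Greatest P"
    by (auto simp: P_def)
  have "A \<subseteq> (\<Union>y\<in>E. ball y \<delta>)"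
  proof (rule ccontr)
    assume "\<not> ?thesis"
    then obtain x where "x \<in> A" "x \<notin> (\<Union>y\<in>E. ball y \<delta>)" by blast
    then have x: "x \<in> A" "\<forall>y\<in>E. \<delta> \<le> dist y x"
      by (auto simp: not_less)
    then have "x \<notin> E" using assms(2) by auto
    have "pairwise (\<lambda>y z. \<delta> \<le> dist y z) (insert x E)"
      using E(3) x(2) by (auto simp: pairwise_insert dist_commute)
    then have "P (Suc (card E))"
      using E x(1) \<open>x \<notin> E\<close> unfolding P_def by (intro exI[of _ "insert x E"]) auto
    from Gmax[OF this] E(4) show False by simp
  qed
  with E that show ?thesis by blast
qed

lemma covering_number_le_card_net:
  fixes A :: "'a::euclidean_space set"
  assumes "finite E" "A \<subseteq> (\<Union>y\<in>E. ball y (r/2))" "r > 0"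
  shows "covering_number r A \<le> enat (card E)"
proof -
  let ?U = "(\<lambda>y. ball y (r/2)) ` E"
  have "finite ?U \<and> (\<forall>U\<in>?U. open U \<and> bounded U \<and> diameter U \<le> r) \<and> A \<subseteq> \<Union>?U"
    using assms by (intro conjI ballI) auto
  then have "covering_number r A \<le> enat (card ?U)"
    unfolding covering_number_def by (intro Inf_lower) blast
  also have "\<dots> \<le> enat (card E)"
    using assms(1) by (simp add: card_image_le)
  finally show ?thesis .
qed

text \<open>
  The infimum of a non-empty set of extended naturals is attained, so a finite bound on the covering
  number yields an actual cover.
\<close>

lemma covering_number_leE:
  assumes "ereal_of_enat (covering_number r A) \<le> ereal c"
  obtains \<U> where "finite \<U>" "\<forall>U\<in>\<U>. bounded U \<and> diameter U \<le> r" "A \<subseteq> \<Union>\<U>" "real (card \<U>) \<le> c"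
proof -
  let ?S = "{enat (card \<U>) | \<U>. finite \<U> \<and>
            (\<forall>U\<in>\<U>. open U \<and> bounded U \<and> diameter U \<le> r) \<and> A \<subseteq> \<Union>\<U>}"
  have "?S \<noteq> {}"
  proof
    assume "?S = {}"
    then have "covering_number r A = \<infinity>"
      unfolding covering_number_def by (simp add: Inf_enat_def)
    with assms show False by simp
  qed
  then obtain k where "k \<in> ?S" by blast
  then have "covering_number r A \<in> ?S"
    unfolding covering_number_def by (rule wellorder_InfI)
  then obtain \<U> where "covering_number r A = enat (card \<U>)" "finite \<U>"
     "\<forall>U\<in>\<U>. bounded U \<and> diameter U \<le> r" "A \<subseteq> \<Union>\<U>" by blast
  with assms that show ?thesis by simp
qed

section \<open>Counting pairs with close images\<close>

text \<open>
  Choose for each point of \<open>E\<close> one set of the cover containing its image.  This splits \<open>E\<close> into at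
  most \<open>card \<U>\<close> classes, and two points of one class have close images.  The Cauchy-Schwarz
  inequality bounds the number of pairs inside classes from below.  Choosing one set per point
  avoids counting a pair twice where sets of the cover overlap.
\<close>

lemma card_squared_le_close_pairs:
  fixes p :: "'b \<Rightarrow> 'a::metric_space"
  assumes "finite E" "finite \<U>" "\<forall>U\<in>\<U>. bounded U \<and> diameter U \<le> r" "p ` E \<subseteq> \<Union>\<U>"
  shows "(real (card E))\<^sup>2 \<le> real (card \<U>) * real (card {q \<in> E \<times> E. dist (p (fst q)) (p (snd q)) \<le> r})"
proof -
  have "\<forall>y\<in>E. \<exists>U. U \<in> \<U> \<and> p y \<in> U"
    using assms(4) by blast
  then obtain f where f: "\<And>y. y \<in> E \<Longrightarrow> f y \<in> \<U> \<and> p y \<in> f y"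
    by (auto dest!: bchoice)
  define fib where "fib U = {y \<in> E. f y = U}" for U
  have fin: "finite (fib U)" for U using assms(1) by (simp add: fib_def)
  have "E = (\<Union>U\<in>\<U>. fib U)"
    using f by (auto simp: fib_def)
  then have "card E = card (\<Union>U\<in>\<U>. fib U)" by simp
  also have "\<dots> = (\<Sum>U\<in>\<U>. card (fib U))"
    using assms(2) fin by (subst card_UN_disjoint) (auto simp: fib_def)
  finally have cE: "real (card E) = (\<Sum>U\<in>\<U>. real (card (fib U)))"
    by simp
  have sq: "(\<Sum>U\<in>\<U>. (real (card (fib U)))\<^sup>2) = real (\<Sum>U\<in>\<U>. card (fib U \<times> fib U))"
    by (simp add: card_cartesian_product power2_eq_square)
  have "(\<Sum>U\<in>\<U>. card (fib U \<times> fib U)) = card (\<Union>U\<in>\<U>. fib U \<times> fib U)"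
    using assms(2) fin by (subst card_UN_disjoint) (auto simp: fib_def)
  also have "\<dots> \<le> card {q \<in> E \<times> E. dist (p (fst q)) (p (snd q)) \<le> r}"
  proof (intro card_mono subsetI)
    show "finite {q \<in> E \<times> E. dist (p (fst q)) (p (snd q)) \<le> r}"
      using assms(1) by simp
    fix q assume "q \<in> (\<Union>U\<in>\<U>. fib U \<times> fib U)"
    then obtain U where U: "U \<in> \<U>" "fst q \<in> fib U" "snd q \<in> fib U" by auto
    then have E: "fst q \<in> E" "snd q \<in> E" and pU: "p (fst q) \<in> U" "p (snd q) \<in> U"
      using f[of "fst q"] f[of "snd q"] by (auto simp: fib_def)
    have "dist (p (fst q)) (p (snd q)) \<le> diameter U"
      using assms(3) U(1) pU by (intro diameter_bounded_bound) auto
    also have "\<dots> \<le> r" using assms(3) U(1) by auto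
    finally show "q \<in> {q \<in> E \<times> E. dist (p (fst q)) (p (snd q)) \<le> r}"
      using E by (simp add: mem_Times_iff)
  qed
  finally have pairs: "(\<Sum>U\<in>\<U>. (real (card (fib U)))\<^sup>2)
      \<le> real (card {q \<in> E \<times> E. dist (p (fst q)) (p (snd q)) \<le> r})"
    unfolding sq by (rule of_nat_mono)
  have "(real (card E))\<^sup>2 \<le> (\<Sum>U\<in>\<U>. (real (card (fib U)))\<^sup>2) * real (card \<U>)"
    unfolding cE by (rule sum_squared_le_sum_of_squares)
  also have "\<dots> \<le> real (card {q \<in> E \<times> E. dist (p (fst q)) (p (snd q)) \<le> r}) * real (card \<U>)"
    using pairs by (intro mult_right_mono) auto
  finally show ?thesis by (simp add: mult.commute)
qed

section \<open>Large Frostman sets below the Assouad dimension\<close>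

text \<open>
  Among the finitely many balls with centre in \<open>E\<^sub>0\<close> and radius \<open>2\<^sup>j\<delta>\<close>, \<open>j \<le> K\<close>, take one
  maximising the number of points divided by \<open>2\<^bsup>js\<^esup>\<close>.  The first inequality compares it with the
  ball that contains all of \<open>E\<^sub>0\<close>; the second one is the Frostman condition.
\<close>

lemma ex_densest_ball:
  fixes E\<^sub>0 :: "'a::metric_space set"
  assumes "finite E\<^sub>0" "y\<^sub>0 \<in> E\<^sub>0" "E\<^sub>0 \<subseteq> ball y\<^sub>0 (2 ^ K * \<delta>)"
  obtains x k where "x \<in> E\<^sub>0"
    "real (card E\<^sub>0) / 2 powr (real K * s) \<le> real (card (E\<^sub>0 \<inter> ball x (2 ^ k * \<delta>))) / 2 powr (real k * s)"
    "\<And>y j. y \<in> E\<^sub>0 \<Longrightarrow> j \<le> k \<Longrightarrow>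
       real (card (E\<^sub>0 \<inter> ball y (2 ^ j * \<delta>))) / 2 powr (real j * s)
         \<le> real (card (E\<^sub>0 \<inter> ball x (2 ^ k * \<delta>))) / 2 powr (real k * s)"
proof -
  define g where "g = (\<lambda>(y, j). real (card (E\<^sub>0 \<inter> ball y (2 ^ j * \<delta>))) / 2 powr (real j * s))"
  have fin: "finite (E\<^sub>0 \<times> {..K})" and ne: "E\<^sub>0 \<times> {..K} \<noteq> {}"
    using assms by auto
  define m where "m = Max (g ` (E\<^sub>0 \<times> {..K}))"
  have "m \<in> g ` (E\<^sub>0 \<times> {..K})"
    unfolding m_def using fin ne by (intro Max_in) auto
  then obtain x k where xk: "x \<in> E\<^sub>0" "k \<le> K" "m = g (x, k)" by auto
  have max: "g (y, j) \<le> g (x, k)" if "y \<in> E\<^sub>0" "j \<le> K" for y j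
    unfolding xk(3)[symmetric] m_def using fin that by (intro Max_ge) auto
  have "E\<^sub>0 \<inter> ball y\<^sub>0 (2 ^ K * \<delta>) = E\<^sub>0" using assms(3) by auto
  with max[OF assms(2), of K] have "real (card E\<^sub>0) / 2 powr (real K * s) \<le> g (x, k)"
    by (simp add: g_def)
  with xk max show ?thesis
    by (intro that[of x k]) (auto simp: g_def)
qed

text \<open>
  A Frostman set of exponent \<open>s\<close> spanning \<open>k \<ge> n\<close> dyadic scales exists inside any set whose Assouad
  dimension exceeds \<open>s\<close>.  The constant \<open>C\<close> in the failing covering estimate is chosen so large that
  the densest ball contains more than \<open>B\<close> points, which is impossible for a \<open>\<delta>\<close>-separated set in a
  ball of radius \<open>2\<^sup>k\<delta>\<close> with \<open>k < n\<close>.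
\<close>

lemma ex_large_frostman_subset:
  fixes F :: "'a::euclidean_space set"
  assumes "0 \<le> s" "ereal s < assouad_dim F"
  obtains E x k \<delta> where "finite E" "E \<subseteq> F" "x \<in> E" "E \<subseteq> ball x (2 ^ k * \<delta>)" "\<delta> > 0" "n \<le> k"
    "\<And>y j. y \<in> E \<Longrightarrow> j \<le> k \<Longrightarrow>
       real (card (E \<inter> ball y (2 ^ j * \<delta>))) / 2 powr (real j * s)
         \<le> real (card E) / 2 powr (real k * s)"
proof -
  define B where "B = (3 * 2 ^ n :: real) ^ DIM('a)"
  define C where "C = 8 powr s * B"
  have "C > 0" by (simp add: C_def B_def)
  define ok where "ok R r x \<longleftrightarrow>
      ereal_of_enat (covering_number r (ball x R \<inter> F)) \<le> ereal (C * (R / r) powr s)" for R r x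
  have "\<not> (\<forall>R>0. \<forall>r\<in>{0<..<R}. \<forall>x\<in>F. ok R r x)"
  proof
    assume *: "\<forall>R>0. \<forall>r\<in>{0<..<R}. \<forall>x\<in>F. ok R r x"
    have "assouad_dim F \<le> ereal s"
      unfolding assouad_dim_def
      by (intro Inf_lower CollectI exI[of _ s] conjI exI[of _ C] refl)
         (use assms(1) \<open>C > 0\<close> * in \<open>simp_all add: ok_def\<close>)
    with assms(2) show False by simp
  qed
  then obtain R r x0 where R: "R > 0" "0 < r" "r < R" "x0 \<in> F" and "\<not> ok R r x0"
    by auto
  then have big: "ereal (C * (R / r) powr s) < ereal_of_enat (covering_number r (ball x0 R \<inter> F))"
    by (simp only: ok_def not_le)
  define \<delta> where "\<delta> = r / 2"
  have "\<delta> > 0" using R by (simp add: \<delta>_def)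
  have "bounded (ball x0 R \<inter> F)" by (rule bounded_subset[OF bounded_ball]) auto
  then obtain E0 where E0: "finite E0" "E0 \<subseteq> ball x0 R \<inter> F" "pairwise (\<lambda>y z. \<delta> \<le> dist y z) E0"
    "ball x0 R \<inter> F \<subseteq> (\<Union>y\<in>E0. ball y \<delta>)"
    using \<open>\<delta> > 0\<close> by (rule ex_maximal_separated_subset)
  have "covering_number r (ball x0 R \<inter> F) \<le> enat (card E0)"
    using E0 R(2) unfolding \<delta>_def by (intro covering_number_le_card_net) auto
  then have "ereal_of_enat (covering_number r (ball x0 R \<inter> F)) \<le> ereal_of_enat (enat (card E0))"
    by (simp only: ereal_of_enat_le_iff)
  with big have "ereal (C * (R / r) powr s) < ereal_of_enat (enat (card E0))"
    by (rule less_le_trans)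
  then have big': "C * (R / r) powr s < real (card E0)"
    by simp
  have "0 < C * (R / r) powr s" using \<open>C > 0\<close> R by simp
  with big' have "E0 \<noteq> {}" by auto
  then obtain y0 where y0: "y0 \<in> E0" by blast
  obtain K0 where K0: "2 * R / \<delta> < 2 ^ K0"
    using real_arch_pow[of 2 "2 * R / \<delta>"] by auto
  let ?Q = "\<lambda>K. 2 * R / \<delta> < 2 ^ K"
  \<comment> \<open>\<open>K\<close> is taken minimal because the density of \<open>E0\<close> at scale \<open>K\<close> must be compared
    with \<open>(R / r) powr s\<close>; this costs the factor \<open>8\<close>.\<close>
  define K where "K = (LEAST K. ?Q K)"
  have QK: "?Q K" unfolding K_def using K0 by (rule LeastI)
  have "K \<noteq> 0" using QK R by (cases "K = 0") (auto simp: \<delta>_def field_simps)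
  then obtain K' where K': "K = Suc K'" by (cases K) auto
  have "\<not> ?Q K'" using not_less_Least[of K' ?Q] K' by (simp add: K_def)
  then have K_le: "2 ^ K \<le> 8 * (R / r)"
    unfolding K' \<delta>_def by (simp add: not_less)
  have E0_ball: "E0 \<subseteq> ball y0 (2 ^ K * \<delta>)"
  proof
    fix z assume "z \<in> E0"
    have "dist y0 z \<le> dist x0 y0 + dist x0 z" by (metis dist_commute dist_triangle)
    also have "\<dots> < R + R" using E0(2) y0 \<open>z \<in> E0\<close> by (intro add_strict_mono) auto
    also have "\<dots> < 2 ^ K * \<delta>" using QK \<open>\<delta> > 0\<close> by (simp add: pos_divide_less_eq)
    finally show "z \<in> ball y0 (2 ^ K * \<delta>)" by simp
  qed
  obtain x k where xk: "x \<in> E0"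
    and dense: "real (card E0) / 2 powr (real K * s)
                  \<le> real (card (E0 \<inter> ball x (2 ^ k * \<delta>))) / 2 powr (real k * s)"
    and frost: "\<And>y j. y \<in> E0 \<Longrightarrow> j \<le> k \<Longrightarrow>
       real (card (E0 \<inter> ball y (2 ^ j * \<delta>))) / 2 powr (real j * s)
         \<le> real (card (E0 \<inter> ball x (2 ^ k * \<delta>))) / 2 powr (real k * s)"
    by (rule ex_densest_ball[OF E0(1) y0 E0_ball, of s]) blast
  define E where "E = E0 \<inter> ball x (2 ^ k * \<delta>)"
  have "n \<le> k"
  proof (rule ccontr)
    assume "\<not> n \<le> k"
    then have kn: "(2::real) ^ k \<le> 2 ^ n" by simp
    have "real (card E) \<le> (2 * (2 ^ k * \<delta>) / \<delta> + 1) ^ DIM('a)"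
    proof (rule card_separated_le)
      show "finite E" "E \<subseteq> ball x (2 ^ k * \<delta>)" using E0(1) by (simp_all add: E_def)
      show "pairwise (\<lambda>y z. \<delta> \<le> dist y z) E"
        by (rule pairwise_subset[OF E0(3)]) (simp add: E_def)
    qed (use \<open>\<delta> > 0\<close> in simp_all)
    also have "\<dots> = (2 * 2 ^ k + 1) ^ DIM('a)"
      using \<open>\<delta> > 0\<close> by simp
    also have "\<dots> \<le> B"
    proof -
      have "(1::real) \<le> 2 ^ n" by simp
      with kn have "2 * 2 ^ k + 1 \<le> (3 * 2 ^ n :: real)" by linarith
      then show ?thesis unfolding B_def by (intro power_mono) auto
    qed
    finally have upper: "real (card E) \<le> B" .
    have "C * (R / r) powr s / (8 * (R / r)) powr s < real (card E0) / (8 * (R / r)) powr s"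
      using big' R by (intro divide_strict_right_mono) auto
    also have "C * (R / r) powr s / (8 * (R / r)) powr s = B"
      using R by (simp add: C_def powr_mult powr_divide)
    also have "real (card E0) / (8 * (R / r)) powr s \<le> real (card E0) / 2 powr (real K * s)"
    proof (intro divide_left_mono)
      have "2 powr (real K * s) = (2 ^ K) powr s"
        by (simp add: powr_powr[symmetric] powr_realpow)
      also have "\<dots> \<le> (8 * (R / r)) powr s"
        using K_le assms(1) by (intro powr_mono2) auto
      finally show "2 powr (real K * s) \<le> (8 * (R / r)) powr s" .
    qed (use R in auto)
    also have "\<dots> \<le> real (card E) / 2 powr (real k * s)"
      using dense by (simp add: E_def)
    also have "\<dots> \<le> real (card E)"
      using assms(1) by (simp add: pos_divide_le_eq mult_le_cancel_left1 ge_one_powr_ge_zero)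
    finally show False using upper by simp
  qed
  show ?thesis
  proof (rule that)
    show "finite E" "E \<subseteq> F" "x \<in> E" "E \<subseteq> ball x (2 ^ k * \<delta>)" "\<delta> > 0" "n \<le> k"
      using E0 xk \<open>\<delta> > 0\<close> \<open>n \<le> k\<close> by (auto simp: E_def)
    fix y j assume "y \<in> E" "j \<le> k"
    have "real (card (E \<inter> ball y (2 ^ j * \<delta>))) \<le> real (card (E0 \<inter> ball y (2 ^ j * \<delta>)))"
      using E0(1) by (intro of_nat_mono card_mono) (auto simp: E_def)
    then have "real (card (E \<inter> ball y (2 ^ j * \<delta>))) / 2 powr (real j * s)
        \<le> real (card (E0 \<inter> ball y (2 ^ j * \<delta>))) / 2 powr (real j * s)"
      by (intro divide_right_mono) auto
    also have "\<dots> \<le> real (card E) / 2 powr (real k * s)"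
      using frost[of y j] \<open>y \<in> E\<close> \<open>j \<le> k\<close> by (simp add: E_def)
    finally show "real (card (E \<inter> ball y (2 ^ j * \<delta>))) / 2 powr (real j * s)
        \<le> real (card E) / 2 powr (real k * s)" .
  qed
qed

section \<open>Directions in which a projected vector is short\<close>

text \<open>
  A weak form of Jordan's inequality, from the cubic Taylor estimate and \<open>pi / 2 < 2\<close>.
\<close>

lemma abs_sin_ge:
  fixes x :: real
  assumes "\<bar>x\<bar> \<le> pi / 2"
  shows "\<bar>x\<bar> / 3 \<le> \<bar>sin x\<bar>"
proof -
  have "\<bar>sin x - (\<Sum>m<3. sin_coeff m * x ^ m)\<bar> \<le> inverse (fact 3) * \<bar>x\<bar> ^ 3"
    by (rule Maclaurin_sin_bound)
  then have 1: "\<bar>sin x - x\<bar> \<le> \<bar>x\<bar> ^ 3 / 6"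
    by (simp add: eval_nat_numeral sin_coeff_def field_simps)
  have "\<bar>x\<bar> \<le> 2" using assms pi_half_less_two by linarith
  then have "\<bar>x\<bar> * \<bar>x\<bar>\<^sup>2 \<le> \<bar>x\<bar> * 2\<^sup>2"
    by (intro mult_left_mono power_mono) auto
  then have "\<bar>x\<bar> ^ 3 \<le> 4 * \<bar>x\<bar>"
    by (simp add: power3_eq_cube power2_eq_square)
  with 1 show ?thesis by linarith
qed

lemma inner_direction_polar:
  fixes v :: "real ^ 2"
  obtains \<phi> where "0 \<le> \<phi>" "\<phi> < 2 * pi" "\<And>\<theta>. v \<bullet> direction \<theta> = norm v * cos (\<theta> - \<phi>)"
proof (cases "v = 0")
  case True
  then show ?thesis using that[of 0] by simp
next
  case False
  have n: "(norm v)\<^sup>2 = (v $ 1)\<^sup>2 + (v $ 2)\<^sup>2"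
    unfolding power2_norm_eq_inner by (simp add: inner_vec_def sum_2 power2_eq_square)
  have "(v $ 1 / norm v)\<^sup>2 + (v $ 2 / norm v)\<^sup>2 = 1"
    using False by (simp add: power_divide n[symmetric] add_divide_distrib[symmetric])
  then obtain \<phi> where \<phi>: "0 \<le> \<phi>" "\<phi> < 2 * pi" "v $ 1 / norm v = cos \<phi>" "v $ 2 / norm v = sin \<phi>"
    using sincos_total_2pi by metis
  then have "v $ 1 = norm v * cos \<phi>" "v $ 2 = norm v * sin \<phi>"
    using False by (auto simp: field_simps)
  then have "v \<bullet> direction \<theta> = norm v * cos (\<theta> - \<phi>)" for \<theta>
    by (simp add: inner_vec_def direction_def sum_2 cos_diff algebra_simps)
  with \<phi> that show ?thesis by blast
qed

lemma small_inner_direction_measurable: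
  "{\<theta> \<in> {0..<pi}. \<bar>v \<bullet> direction \<theta>\<bar> \<le> \<delta>} \<in> lmeasurable"
proof -
  obtain \<phi> where \<phi>: "\<And>\<theta>. v \<bullet> direction \<theta> = norm v * cos (\<theta> - \<phi>)"
    using inner_direction_polar by blast
  have "{\<theta>. \<bar>v \<bullet> direction \<theta>\<bar> \<le> \<delta>} \<in> sets borel"
    unfolding \<phi> by measurable
  then have "{0..<pi} \<inter> {\<theta>. \<bar>v \<bullet> direction \<theta>\<bar> \<le> \<delta>} \<in> sets borel"
    by auto
  also have "{0..<pi} \<inter> {\<theta>. \<bar>v \<bullet> direction \<theta>\<bar> \<le> \<delta>} = {\<theta> \<in> {0..<pi}. \<bar>v \<bullet> direction \<theta>\<bar> \<le> \<delta>}"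
    by auto
  finally have "{\<theta> \<in> {0..<pi}. \<bar>v \<bullet> direction \<theta>\<bar> \<le> \<delta>} \<in> sets lebesgue"
    by simp
  moreover have "bounded {\<theta> \<in> {0..<pi}. \<bar>v \<bullet> direction \<theta>\<bar> \<le> \<delta>}"
    by (rule bounded_subset[of "{0..pi}"]) (simp, force)
  ultimately show ?thesis
    by (intro bounded_set_imp_lmeasurable)
qed

text \<open>
  Transversality.  In polar coordinates \<open>v \<bullet> direction \<theta>\<close> is \<open>norm v\<close> times the sine of
  \<open>\<theta> - \<phi> + pi/2\<close>, which is small only near a multiple of \<open>pi\<close>.  That argument lies within
  \<open>3/2 * pi\<close> of \<open>0\<close>, so five multiples of \<open>pi\<close> are enough, each contributing an interval of length
  \<open>6\<delta>/norm v\<close>.  The maximum with \<open>\<delta>\<close> covers short vectors, including \<open>v = 0\<close>, where only the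
  trivial bound holds.
\<close>

lemma measure_small_inner_direction_le:
  fixes v :: "real ^ 2"
  assumes "\<delta> > 0"
  shows "measure lebesgue {\<theta> \<in> {0..<pi}. \<bar>v \<bullet> direction \<theta>\<bar> \<le> \<delta>} \<le> 30 * (\<delta> / max \<delta> (norm v))"
proof (cases "norm v \<le> \<delta>")
  case True
  have "measure lebesgue {\<theta> \<in> {0..<pi}. \<bar>v \<bullet> direction \<theta>\<bar> \<le> \<delta>} \<le> measure lebesgue {0..pi}"
    using small_inner_direction_measurable by (intro measure_mono_fmeasurable) auto
  also have "\<dots> \<le> 30"
    using pi_less_4 by simp
  finally show ?thesis using True assms by (simp add: max_absorb1)
next
  case False
  obtain \<phi> where \<phi>: "0 \<le> \<phi>" "\<phi> < 2 * pi" "\<And>\<theta>. v \<bullet> direction \<theta> = norm v * cos (\<theta> - \<phi>)"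
    using inner_direction_polar by blast
  define u where "u = \<delta> / norm v"
  have "norm v > 0" using False assms by linarith
  with assms have "u > 0" by (simp add: u_def)
  define c where "c k = \<phi> - pi/2 + of_int k * pi" for k :: int
  have "{\<theta> \<in> {0..<pi}. \<bar>v \<bullet> direction \<theta>\<bar> \<le> \<delta>} \<subseteq> (\<Union>k\<in>{-2..2}. {c k - 3*u .. c k + 3*u})"
  proof clarsimp
    fix \<theta> assume \<theta>: "0 \<le> \<theta>" "\<theta> < pi" "\<bar>v \<bullet> direction \<theta>\<bar> \<le> \<delta>"
    define t where "t = \<theta> - \<phi> + pi/2"
    define k where "k = round (t / pi)"
    define w where "w = t - of_int k * pi"
    have "\<bar>t / pi - of_int k\<bar> \<le> 1/2"
      unfolding k_def abs_minus_commute[of "t / pi"] by (rule of_int_round_abs_le)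
    then have "pi * \<bar>t / pi - of_int k\<bar> \<le> pi * (1/2)"
      by (rule mult_left_mono) simp
    also have "pi * \<bar>t / pi - of_int k\<bar> = \<bar>pi * (t / pi - of_int k)\<bar>"
      by (simp add: abs_mult)
    also have "pi * (t / pi - of_int k) = w"
      by (simp add: w_def right_diff_distrib mult.commute)
    finally have w: "\<bar>w\<bar> \<le> pi / 2" by simp
    have "cos (\<theta> - \<phi>) = sin t"
      by (simp add: t_def sin_add)
    also have "\<bar>sin t\<bar> = \<bar>sin w\<bar>"
      by (simp add: w_def sin_diff abs_mult mult.commute[of _ pi] sin_npi_int cos_npi_int)
    finally have "\<bar>sin w\<bar> \<le> u"
      using \<theta>(3) \<open>norm v > 0\<close> by (simp add: \<phi>(3) abs_mult u_def pos_le_divide_eq mult.commute)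
    then have "\<bar>w\<bar> \<le> 3 * u"
      using abs_sin_ge[OF w] by linarith
    moreover have "\<theta> = c k + w"
      by (simp add: c_def t_def w_def)
    ultimately have "c k - 3*u \<le> \<theta> \<and> \<theta> \<le> c k + 3*u"
      by (simp add: abs_le_iff)
    moreover have "-2 \<le> k \<and> k \<le> 2"
    proof -
      have "t < 3/2 * pi" unfolding t_def using \<theta>(2) \<phi>(1) by linarith
      moreover have "- (3/2 * pi) < t" unfolding t_def using \<theta>(1) \<phi>(2) by linarith
      moreover have "of_int k * pi = t - w" by (simp add: w_def)
      ultimately have "\<bar>of_int k * pi\<bar> < 3 * pi" using w pi_gt_zero by linarith
      then have "\<bar>real_of_int k\<bar> < 3" by (simp add: abs_mult)
      then show ?thesis by linarith
    qed
    ultimately show "\<exists>k\<in>{-2..2}. c k - 3*u \<le> \<theta> \<and> \<theta> \<le> c k + 3*u" by auto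
  qed
  then have "measure lebesgue {\<theta> \<in> {0..<pi}. \<bar>v \<bullet> direction \<theta>\<bar> \<le> \<delta>}
      \<le> measure lebesgue (\<Union>k\<in>{-2..2}. {c k - 3*u .. c k + 3*u})"
    using small_inner_direction_measurable
    by (intro measure_mono_fmeasurable) (auto intro!: fmeasurable.finite_UN)
  also have "\<dots> \<le> (\<Sum>k\<in>{-2..2::int}. measure lebesgue {c k - 3*u .. c k + 3*u})"
    by (intro measure_UNION_le) auto
  also have "\<dots> = 30 * u"
    using \<open>u > 0\<close> by simp
  finally show ?thesis using False by (simp add: u_def max_absorb2)
qed

text \<open>
  Markov's inequality, applied to the sum of the indicator functions.
\<close>

lemma measure_card_ge_le:
  fixes A :: "'i \<Rightarrow> 'a set"
  assumes "finite I" "\<And>i. i \<in> I \<Longrightarrow> A i \<in> fmeasurable M" "a > 0"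
  shows "{x \<in> space M. a \<le> real (card {i \<in> I. x \<in> A i})} \<in> fmeasurable M" (is "?T \<in> _")
    and "measure M {x \<in> space M. a \<le> real (card {i \<in> I. x \<in> A i})} \<le> (\<Sum>i\<in>I. measure M (A i)) / a"
proof -
  have sets: "\<And>i. i \<in> I \<Longrightarrow> A i \<in> sets M" using assms(2) by auto
  have eq: "real (card {i \<in> I. x \<in> A i}) = (\<Sum>i\<in>I. indicat_real (A i) x)" for x
    using assms(1) by (simp add: indicator_def sum_of_bool_eq Int_def)
  have int: "integrable M (\<lambda>x. \<Sum>i\<in>I. indicat_real (A i) x)"
    using assms(2) by (intro Bochner_Integration.integrable_sum) (auto simp: fmeasurable_def)
  have pos: "AE x in M. 0 \<le> (\<Sum>i\<in>I. indicat_real (A i) x)"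
    by (simp add: sum_nonneg)
  have T: "?T \<in> sets M"
    unfolding eq using int by (intro borel_measurable_le) auto
  have "emeasure M ?T \<le> ennreal (1 / a * (\<integral>x. (\<Sum>i\<in>I. indicat_real (A i) x) \<partial>M))"
    unfolding eq by (rule integral_Markov_inequality[OF int pos assms(3)])
  also have "\<dots> < \<infinity>" by simp
  finally show "?T \<in> fmeasurable M"
    using T by (simp add: fmeasurable_def)
  have "measure M ?T \<le> (\<integral>x. (\<Sum>i\<in>I. indicat_real (A i) x) \<partial>M) / a"
    unfolding eq by (rule integral_Markov_inequality_measure[OF int _ pos assms(3)]) (rule sets.empty_sets)
  also have "(\<integral>x. (\<Sum>i\<in>I. indicat_real (A i) x) \<partial>M) = (\<Sum>i\<in>I. measure M (A i))"
    using assms(2) sets by (subst Bochner_Integration.integral_sum) (auto simp: fmeasurable_def Int_absorb2 sets.sets_into_space)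
  finally show "measure M ?T \<le> (\<Sum>i\<in>I. measure M (A i)) / a" .
qed

section \<open>Energy of Frostman sets and exceptional directions\<close>

lemma dist_proj_line:
  "dist (proj_line \<theta> y) (proj_line \<theta> z) = \<bar>(y - z) \<bullet> direction \<theta>\<bar>"
proof -
  have "proj_line \<theta> y - proj_line \<theta> z = ((y - z) \<bullet> direction \<theta>) *\<^sub>R direction \<theta>"
    by (simp add: proj_line_def inner_diff_left scaleR_left_diff_distrib)
  then show ?thesis
    by (simp add: dist_norm norm_direction)
qed

lemma dist_proj_line_le: "dist (proj_line \<theta> y) (proj_line \<theta> z) \<le> dist y z"
  using Cauchy_Schwarz_ineq2[of "y - z" "direction \<theta>"]
  unfolding dist_proj_line by (simp add: norm_direction dist_norm)

text \<open>
  The discrete \<open>1\<close>-energy of a Frostman set of exponent \<open>s < 1\<close>, truncated at \<open>\<delta>\<close>.  The kernel is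
  at most \<open>2 \<cdot> 2\<^bsup>-j\<^esup>\<close> off the ball of radius \<open>2\<^bsup>j-1\<^esup>\<delta>\<close>, and the ball of radius \<open>2\<^sup>j\<delta>\<close> holds at most the
  fraction \<open>2\<^bsup>(j-k)s\<^esup>\<close> of the points, so the shells contribute a geometric series of ratio
  \<open>2\<^bsup>s-1\<^esup> < 1\<close>.
\<close>

lemma frostman_energy_le:
  fixes E :: "'a::metric_space set"
  assumes "finite E" "y \<in> E" "E \<subseteq> ball x (2 ^ k * \<delta>)" "\<delta> > 0" "0 \<le> s" "s < 1"
    and frost: "\<And>j. j \<le> k \<Longrightarrow> real (card (E \<inter> ball y (2 ^ j * \<delta>))) / 2 powr (real j * s)
                  \<le> real (card E) / 2 powr (real k * s)"
  shows "(\<Sum>z\<in>E. \<delta> / max \<delta> (dist y z))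
           \<le> 2 / (1 - 2 powr (s - 1)) * (real (card E) / 2 powr (real k * s))"
proof -
  define w :: real where "w = 2 powr (s - 1)"
  have w: "0 < w" "w < 1"
    using assms(6) powr_less_one[of 2 "s - 1"] by (auto simp: w_def)
  define m where "m = real (card E) / 2 powr (real k * s)"
  have "m \<ge> 0" by (simp add: m_def)
  \<comment> \<open>Beyond scale \<open>k\<close> the Frostman bound is at least \<open>card E\<close> and holds trivially; scale \<open>k + 1\<close> is
    needed because two points of a ball of radius \<open>2\<^sup>k\<delta>\<close> can be almost \<open>2\<^bsup>k+1\<^esup>\<delta>\<close> apart.\<close>
  have frost': "real (card (E \<inter> ball y (2 ^ j * \<delta>))) \<le> 2 powr (real j * s) * m" for j
  proof (cases "j \<le> k")
    case True
    then show ?thesis using frost[OF True] by (simp add: m_def pos_divide_le_eq mult.commute)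
  next
    case False
    have "real (card (E \<inter> ball y (2 ^ j * \<delta>))) \<le> real (card E)"
      using assms(1) by (simp add: card_mono)
    also have "\<dots> = 2 powr (real k * s) * m" by (simp add: m_def)
    also have "\<dots> \<le> 2 powr (real j * s) * m"
      using False assms(5) \<open>m \<ge> 0\<close> by (intro mult_right_mono powr_mono) auto
    finally show ?thesis .
  qed
  have shell: "\<delta> / max \<delta> (dist y z)
      \<le> (\<Sum>j<k+2. 2 * (1/2) ^ j * indicator (ball y (2 ^ j * \<delta>)) z)" if "z \<in> E" for z
  proof -
    let ?P = "\<lambda>j. dist y z < 2 ^ j * \<delta>"
    have "dist y z \<le> dist x y + dist x z" by (metis dist_commute dist_triangle)
    also have "\<dots> < 2 ^ k * \<delta> + 2 ^ k * \<delta>"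
      using assms(2,3) that by (intro add_strict_mono) auto
    finally have Pk: "?P (k+1)" by (simp add: algebra_simps)
    define j where "j = (LEAST j. ?P j)"
    have Pj: "?P j" unfolding j_def using Pk by (rule LeastI)
    have "j \<le> k+1" unfolding j_def using Pk by (rule Least_le)
    have "\<delta> / max \<delta> (dist y z) \<le> 2 * (1/2) ^ j"
    proof (cases j)
      case 0
      have "\<delta> / max \<delta> (dist y z) \<le> 1" using assms(4) by (simp add: divide_le_eq)
      with 0 show ?thesis by simp
    next
      case (Suc i)
      then have "\<not> ?P i" using not_less_Least[of i ?P] by (simp add: j_def)
      then have "2 ^ i * \<delta> \<le> max \<delta> (dist y z)" by simp
      then have "\<delta> / max \<delta> (dist y z) \<le> \<delta> / (2 ^ i * \<delta>)"
        using assms(4) by (intro divide_left_mono) auto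
      also have "\<dots> = 2 * (1/2) ^ j"
        using assms(4) Suc by (simp add: power_divide)
      finally show ?thesis .
    qed
    also have "\<dots> = 2 * (1/2) ^ j * indicator (ball y (2 ^ j * \<delta>)) z"
      using Pj by simp
    also have "\<dots> \<le> (\<Sum>j<k+2. 2 * (1/2) ^ j * indicator (ball y (2 ^ j * \<delta>)) z)"
      using \<open>j \<le> k+1\<close>
      by (intro member_le_sum[of j "{..<k+2}" "\<lambda>j. 2 * (1/2) ^ j * indicat_real (ball y (2 ^ j * \<delta>)) z"]) auto
    finally show ?thesis .
  qed
  have "(\<Sum>z\<in>E. \<delta> / max \<delta> (dist y z))
      \<le> (\<Sum>z\<in>E. \<Sum>j<k+2. 2 * (1/2) ^ j * indicat_real (ball y (2 ^ j * \<delta>)) z)"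
    by (intro sum_mono shell)
  also have "\<dots> = (\<Sum>j<k+2. 2 * (1/2) ^ j * (\<Sum>z\<in>E. indicat_real (ball y (2 ^ j * \<delta>)) z))"
    by (subst sum.swap) (simp only: sum_distrib_left)
  also have "\<dots> = (\<Sum>j<k+2. 2 * (1/2) ^ j * real (card (E \<inter> ball y (2 ^ j * \<delta>))))"
  proof -
    have "(\<Sum>z\<in>E. indicat_real B z) = real (card (E \<inter> B))" for B
      using assms(1) by (simp add: indicator_def sum_of_bool_eq Int_def)
    then show ?thesis by simp
  qed
  also have "\<dots> \<le> (\<Sum>j<k+2. 2 * (1/2) ^ j * (2 powr (real j * s) * m))"
    by (intro sum_mono mult_left_mono frost') auto
  also have "\<dots> = (\<Sum>j<k+2. 2 * m * w ^ j)"
  proof (rule sum.cong[OF refl])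
    fix j
    have "w ^ j = 2 powr (real j * (s - 1))"
      unfolding w_def by (simp add: powr_power mult.commute)
    also have "\<dots> = 2 powr (real j * s) / 2 powr real j"
      by (simp add: right_diff_distrib powr_diff)
    also have "\<dots> = (1/2) ^ j * 2 powr (real j * s)"
      by (simp add: powr_realpow power_divide)
    finally show "2 * (1/2) ^ j * (2 powr (real j * s) * m) = 2 * m * w ^ j"
      by simp
  qed
  also have "\<dots> = 2 * m * ((1 - w ^ (k+2)) / (1 - w))"
    using w by (simp only: sum_distrib_left[symmetric] sum_gp_strict) simp
  also have "\<dots> \<le> 2 * m * (1 / (1 - w))"
    using w \<open>m \<ge> 0\<close> by (intro mult_left_mono divide_right_mono) auto
  finally show ?thesis by (simp add: m_def w_def mult.commute)
qed

lemma sum_measure_close_directions_le: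
  fixes E :: "(real ^ 2) set"
  assumes "finite E" "E \<subseteq> ball x (2 ^ k * \<delta>)" "\<delta> > 0" "0 \<le> s" "s < 1"
    and frost: "\<And>y j. y \<in> E \<Longrightarrow> j \<le> k \<Longrightarrow>
                  real (card (E \<inter> ball y (2 ^ j * \<delta>))) / 2 powr (real j * s)
                    \<le> real (card E) / 2 powr (real k * s)"
  shows "(\<Sum>q\<in>E\<times>E. measure lebesgue {\<theta> \<in> {0..<pi}. \<bar>(fst q - snd q) \<bullet> direction \<theta>\<bar> \<le> \<delta>})
           \<le> 60 / (1 - 2 powr (s - 1)) * ((real (card E))\<^sup>2 / 2 powr (real k * s))"
proof -
  have "(\<Sum>q\<in>E\<times>E. measure lebesgue {\<theta> \<in> {0..<pi}. \<bar>(fst q - snd q) \<bullet> direction \<theta>\<bar> \<le> \<delta>})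
      \<le> (\<Sum>q\<in>E\<times>E. 30 * (\<delta> / max \<delta> (dist (fst q) (snd q))))"
    unfolding dist_norm by (intro sum_mono measure_small_inner_direction_le assms)
  also have "\<dots> = 30 * (\<Sum>y\<in>E. \<Sum>z\<in>E. \<delta> / max \<delta> (dist y z))"
    by (simp add: sum_distrib_left sum.cartesian_product case_prod_beta)
  also have "\<dots> \<le> 30 * (\<Sum>y\<in>E. 2 / (1 - 2 powr (s - 1)) * (real (card E) / 2 powr (real k * s)))"
    using assms by (intro mult_left_mono sum_mono frostman_energy_le[where x = x]) auto
  also have "\<dots> = 60 / (1 - 2 powr (s - 1)) * ((real (card E))\<^sup>2 / 2 powr (real k * s))"
    by (simp add: power2_eq_square)
  finally show ?thesis .
qed

text \<open>
  The exceptional set is squeezed into the set \<open>T\<close> of angles for which at least \<open>a\<close> pairs of a large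
  Frostman set \<open>E\<close> have \<open>\<delta>\<close>-close projections.  The set \<open>T\<close> is measurable, and its measure is at
  most a constant times \<open>2\<^bsup>k(t-s)\<^esup>\<close>.
\<close>

lemma negligible_exceptional_directions:
  fixes F :: "(real ^ 2) set"
  assumes "0 \<le> s" "s < 1" "ereal s < assouad_dim F" "t < s" "C > 0"
  shows "negligible {\<theta> \<in> {0..<pi}. \<forall>R>0. \<forall>r\<in>{0<..<R}. \<forall>x\<in>proj_line \<theta> ` F.
           ereal_of_enat (covering_number r (ball x R \<inter> proj_line \<theta> ` F)) \<le> ereal (C * (R / r) powr t)}"
    (is "negligible ?bad")
  unfolding negligible_outer_le
proof (intro allI impI)
  fix e :: real assume "e > 0"
  define c where "c = 60 / (1 - 2 powr (s - 1)) * C"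
  have "(2::real) powr (s - 1) < 1" using assms(2) powr_less_one[of 2 "s - 1"] by auto
  then have "c > 0" using assms(5) by (simp add: c_def)
  have u: "(2::real) powr (t - s) < 1" using assms(4) powr_less_one[of 2 "t - s"] by auto
  then obtain n0 where n0: "(2 powr (t - s)) ^ n0 < e / c"
    using real_arch_pow_inv[of "e / c" "2 powr (t - s)"] \<open>e > 0\<close> \<open>c > 0\<close> by auto
  \<comment> \<open>\<open>Suc n0\<close> rather than \<open>n0\<close> ensures \<open>k \<ge> 1\<close>, hence \<open>\<delta> < 2 ^ k * \<delta>\<close>: the defining estimate
    is available only for two distinct scales.\<close>
  obtain E x k \<delta> where E: "finite E" "E \<subseteq> F" "x \<in> E" "E \<subseteq> ball x (2 ^ k * \<delta>)" "\<delta> > 0" "Suc n0 \<le> k"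
    and frost: "\<And>y j. y \<in> E \<Longrightarrow> j \<le> k \<Longrightarrow>
       real (card (E \<inter> ball y (2 ^ j * \<delta>))) / 2 powr (real j * s)
         \<le> real (card E) / 2 powr (real k * s)"
    by (rule ex_large_frostman_subset[OF assms(1,3), of "Suc n0"]) blast
  have cardE: "real (card E) > 0" using E(1,3) by (auto simp: card_gt_0_iff)
  define N where "N = C * 2 powr (real k * t)"
  have "N > 0" using assms(5) by (simp add: N_def)
  define a where "a = (real (card E))\<^sup>2 / N"
  have "a > 0" using cardE \<open>N > 0\<close> by (simp add: a_def)
  define D where "D q = {\<theta> \<in> {0..<pi}. \<bar>(fst q - snd q) \<bullet> direction \<theta>\<bar> \<le> \<delta>}" for q
  define T where "T = {\<theta> \<in> space lebesgue. a \<le> real (card {q \<in> E \<times> E. \<theta> \<in> D q})}"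
  have D: "D q \<in> lmeasurable" for q
    unfolding D_def by (rule small_inner_direction_measurable)
  have "finite (E \<times> E)" using E(1) by simp
  note markov = measure_card_ge_le[of "E \<times> E" D lebesgue a, OF this D \<open>a > 0\<close>, folded T_def]
  have "measure lebesgue T \<le> (\<Sum>q\<in>E\<times>E. measure lebesgue (D q)) / a"
    by (rule markov(2))
  also have "\<dots> \<le> (60 / (1 - 2 powr (s - 1)) * ((real (card E))\<^sup>2 / 2 powr (real k * s))) / a"
    unfolding D_def using \<open>a > 0\<close> E assms frost
    by (intro divide_right_mono sum_measure_close_directions_le[where x = x]) auto
  also have "\<dots> = c * 2 powr (real k * (t - s))"
    using cardE assms(5) by (simp add: a_def N_def c_def right_diff_distrib powr_diff)
  also have "\<dots> = c * (2 powr (t - s)) ^ k"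
    by (simp add: powr_power mult.commute)
  also have "\<dots> \<le> c * (2 powr (t - s)) ^ n0"
    using \<open>c > 0\<close> u E(6) by (intro mult_left_mono power_decreasing) auto
  also have "\<dots> \<le> e"
    using n0 \<open>c > 0\<close> by (simp add: pos_less_divide_eq mult.commute)
  finally have small: "measure lebesgue T \<le> e" .
  have "?bad \<subseteq> T"
  proof clarify
    fix \<theta> assume \<theta>: "\<theta> \<in> {0..<pi}"
      and bad: "\<forall>R>0. \<forall>r\<in>{0<..<R}. \<forall>x\<in>proj_line \<theta> ` F.
           ereal_of_enat (covering_number r (ball x R \<inter> proj_line \<theta> ` F)) \<le> ereal (C * (R / r) powr t)"
    define A where "A = ball (proj_line \<theta> x) (2 ^ k * \<delta>) \<inter> proj_line \<theta> ` F"
    have k1: "(1::real) < 2 ^ k" using E(6) by (intro one_less_power) auto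
    have "ereal_of_enat (covering_number \<delta> A) \<le> ereal (C * (2 ^ k * \<delta> / \<delta>) powr t)"
      unfolding A_def
    proof (rule bad[rule_format])
      show "0 < 2 ^ k * \<delta>" "\<delta> \<in> {0<..<2 ^ k * \<delta>}"
        using E(5) k1 by simp_all
      show "proj_line \<theta> x \<in> proj_line \<theta> ` F" using E(2,3) by blast
    qed
    also have "C * (2 ^ k * \<delta> / \<delta>) powr t = N"
      using E(5) by (simp add: N_def powr_powr[symmetric] powr_realpow)
    finally obtain \<U> where \<U>: "finite \<U>" "\<forall>U\<in>\<U>. bounded U \<and> diameter U \<le> \<delta>" "A \<subseteq> \<Union>\<U>" "real (card \<U>) \<le> N"
      by (rule covering_number_leE)
    have "proj_line \<theta> ` E \<subseteq> A"
    proof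
      fix w assume "w \<in> proj_line \<theta> ` E"
      then obtain y where y: "y \<in> E" "w = proj_line \<theta> y" by blast
      then have "dist x y < 2 ^ k * \<delta>" using E(4) by auto
      with dist_proj_line_le[of \<theta> x y] y E(2) show "w \<in> A" by (auto simp: A_def)
    qed
    then have "proj_line \<theta> ` E \<subseteq> \<Union>\<U>" using \<U>(3) by blast
    then have "(real (card E))\<^sup>2 \<le> real (card \<U>) *
        real (card {q \<in> E \<times> E. dist (proj_line \<theta> (fst q)) (proj_line \<theta> (snd q)) \<le> \<delta>})"
      using E(1) \<U> by (intro card_squared_le_close_pairs) auto
    also have "{q \<in> E \<times> E. dist (proj_line \<theta> (fst q)) (proj_line \<theta> (snd q)) \<le> \<delta>}
        = {q \<in> E \<times> E. \<theta> \<in> D q}"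
      using \<theta> by (simp add: D_def dist_proj_line)
    also have "real (card \<U>) * real (card {q \<in> E \<times> E. \<theta> \<in> D q})
        \<le> N * real (card {q \<in> E \<times> E. \<theta> \<in> D q})"
      using \<U>(4) by (intro mult_right_mono) auto
    finally show "\<theta> \<in> T"
      using \<open>N > 0\<close> by (simp add: T_def a_def pos_divide_le_eq mult.commute)
  qed
  with markov(1) small show "\<exists>T. ?bad \<subseteq> T \<and> T \<in> lmeasurable \<and> measure lebesgue T \<le> e"
    by blast
qed

theorem theorem2p1:
  fixes F :: "(real ^ 2) set"
  assumes "F \<noteq> {}"
  shows "AE \<theta>\<in>{0..<pi} in lebesgue.
           assouad_dim (proj_line \<theta> ` F) \<ge> min (assouad_dim F) 1"
proof -
  let ?d = "min (assouad_dim F) 1"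
  define bad where "bad t C = {\<theta> \<in> {0..<pi}. \<forall>R>0. \<forall>r\<in>{0<..<R}. \<forall>x\<in>proj_line \<theta> ` F.
      ereal_of_enat (covering_number r (ball x R \<inter> proj_line \<theta> ` F)) \<le> ereal (C * (R / r) powr t)}"
    for t C :: real
  \<comment> \<open>Since \<open>R / r > 1\<close>, the estimate with \<open>(t, C)\<close> persists when \<open>t\<close> or \<open>C\<close> grows, so rational exponents
    and integer constants capture every exceptional angle.\<close>
  define Q where "Q = {t \<in> \<rat>. 0 \<le> t \<and> ereal t < ?d}"
  define X where "X = (\<Union>t\<in>Q. \<Union>n. bad t (real (Suc n)))"
  have null: "negligible (bad t C)" if t: "0 \<le> t" "ereal t < ?d" and "C > 0" for t C
  proof -
    obtain s where s: "ereal t < ereal s" "ereal s < ?d"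
      using ereal_dense2[OF t(2)] by blast
    then show ?thesis
      unfolding bad_def using t(1) \<open>C > 0\<close>
      by (intro negligible_exceptional_directions[of s]) (auto simp: one_ereal_def)
  qed
  have "countable Q"
    unfolding Q_def by (rule countable_subset[OF _ countable_rat]) auto
  then have "X \<in> null_sets lebesgue"
    unfolding X_def using null
    by (intro null_sets_UN' null_sets_UN) (auto simp: Q_def negligible_iff_null_sets)
  moreover have "{\<theta> \<in> space lebesgue. \<not> (\<theta> \<in> {0..<pi} \<longrightarrow> ?d \<le> assouad_dim (proj_line \<theta> ` F))} \<subseteq> X"
  proof clarsimp
    fix \<theta> assume \<theta>: "0 \<le> \<theta>" "\<theta> < pi" and "\<not> ?d \<le> assouad_dim (proj_line \<theta> ` F)"
    then have "assouad_dim (proj_line \<theta> ` F) < ?d" by (simp only: not_le)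
    then obtain s C where s: "0 \<le> s" "ereal s < ?d" and C: "C > 0"
      "\<forall>R>0. \<forall>r\<in>{0<..<R}. \<forall>x\<in>proj_line \<theta> ` F.
         ereal_of_enat (covering_number r (ball x R \<inter> proj_line \<theta> ` F)) \<le> ereal (C * (R / r) powr s)"
      unfolding assouad_dim_def Inf_less_iff by blast
    obtain s' where s': "ereal s < ereal s'" "ereal s' < ?d"
      using ereal_dense2[OF s(2)] by blast
    then obtain t where t: "t \<in> \<rat>" "s < t" "t < s'"
      using Rats_dense_in_real[of s s'] by auto
    have "ereal t < ?d"
      using t(3) s'(2) by (meson ereal_less(1) less_ereal.simps(1) less_trans)
    then have "t \<in> Q" using t s(1) by (simp add: Q_def)
    obtain n where n: "C \<le> real (Suc n)"
      using real_arch_simple[of C] by (metis le_SucI of_nat_mono order_trans order_refl)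
    have "\<theta> \<in> bad t (real (Suc n))"
      unfolding bad_def
    proof (intro CollectI conjI allI impI ballI)
      show "\<theta> \<in> {0..<pi}" using \<theta> by simp
      fix R r :: real and x assume R: "0 < R" "r \<in> {0<..<R}" "x \<in> proj_line \<theta> ` F"
      then have "ereal_of_enat (covering_number r (ball x R \<inter> proj_line \<theta> ` F)) \<le> ereal (C * (R / r) powr s)"
        using C(2) by blast
      also have "\<dots> \<le> ereal (real (Suc n) * (R / r) powr t)"
        using R n t(2) C(1) by (auto intro!: mult_mono powr_mono)
      finally show "ereal_of_enat (covering_number r (ball x R \<inter> proj_line \<theta> ` F))
          \<le> ereal (real (Suc n) * (R / r) powr t)" .
    qed
    then show "\<theta> \<in> X" using \<open>t \<in> Q\<close> unfolding X_def by blast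
  qed
  ultimately show ?thesis by (rule AE_I')
qed

end
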